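(* Let $a,b$ be coprime positive integers. For every integer $n\ge 1$, $$\{k+(n-1)ab:\ k\in Ap_{ab}(S_{a,b})\}=R_n(a,b).$$
   Context: For coprime positive integers $a,b$, $S_{a,b}=\{ua+vb:\ u,v\in\mathbb{Z}_{\ge 0}\}$ is the numerical semigroup generated by $a$ and $b$. For a nonzero $m\in S_{a,b}$ the Apéry set is $Ap_m(S_{a,b}):=\{s\in S_{a,b}:\ s-m\notin S_{a,b}\}$. $R_n(a,b)$ is the set of all elements of $S_{a,b}$ having exactly $n$ representations as a linear combination $ua+vb$ of the generators with $u,v\in\mathbb{Z}_{\ge 0}$ (representations are counted as pairs $(u,v)$). *)

theory Defs
  imports Main
begin

definition num_semigroup :: "nat \<Rightarrow> nat \<Rightarrow> nat set" where
  "num_semigroup a b = {u * a + v * b | u v. True}"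

(* The difference s - m is taken in the integers, since natural subtraction truncates:
   an s < m always belongs to the Apery set. *)
definition apery_set :: "nat set \<Rightarrow> nat \<Rightarrow> nat set" where
  "apery_set S m = {s \<in> S. int s - int m \<notin> int ` S}"

definition representations :: "nat \<Rightarrow> nat \<Rightarrow> nat \<Rightarrow> (nat \<times> nat) set" where
  "representations a b s = {(u, v). s = u * a + v * b}"

(* For a, b > 0 every set of representations is finite, so card is the true count. *)
definition rep_set :: "nat \<Rightarrow> nat \<Rightarrow> nat \<Rightarrow> nat set" where
  "rep_set n a b = {s \<in> num_semigroup a b. card (representations a b s) = n}"

end

theory Submission
  imports Defs "HOL-Number_Theory.Cong"
begin

text \<open>Let \<open>N s\<close> be the number of representations of \<open>s\<close>. Modulo \<open>b\<close>, exactly one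
  \<open>u < b\<close> satisfies \<open>u a = s\<close>, and \<open>u a < a b\<close>; so \<open>s + a b\<close> has exactly one representation
  with \<open>u < b\<close>, while those with \<open>u \<ge> b\<close> correspond to the representations of \<open>s\<close>. Hence
  \<open>N (s + a b) = N s + 1\<close> for every natural \<open>s\<close>, whether in the semigroup or not. As
  \<open>N s \<le> 1\<close> for \<open>s < a b\<close>, the Apery set is \<open>{s. N s = 1}\<close>, and shifting by \<open>(n - 1) a b\<close>
  gives the theorem.\<close>

lemma mem_representations_iff [simp]:
  "(u, v) \<in> representations a b s \<longleftrightarrow> s = u * a + v * b"
  by (simp add: representations_def)

lemma finite_representations:
  assumes "a > 0" and "b > 0"
  shows "finite (representations a b s)"
proof (rule finite_subset)
  have "u \<le> u * a + v * b \<and> v \<le> u * a + v * b" for u v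
    using assms by (simp add: trans_le_add1 trans_le_add2)
  then show "representations a b s \<subseteq> {..s} \<times> {..s}"
    unfolding representations_def by blast
qed simp

text \<open>Finiteness matters here: \<open>card\<close> of an infinite set is 0, so only for a
  finite set does \<open>card\<close> 0 mean that there is no representation.\<close>

lemma num_semigroup_iff_card_representations:
  assumes "a > 0" and "b > 0"
  shows "s \<in> num_semigroup a b \<longleftrightarrow> card (representations a b s) \<noteq> 0"
proof -
  have "s \<in> num_semigroup a b \<longleftrightarrow> representations a b s \<noteq> {}"
    by (auto simp: num_semigroup_def representations_def)
  then show ?thesis
    using finite_representations[OF assms] by simp
qed

text \<open>Reducing modulo \<open>b\<close> and cancelling the unit \<open>a\<close> makes
  \<open>u\<close> and \<open>u'\<close> congruent, and both are below \<open>b\<close>.\<close>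

lemma small_representation_unique:
  fixes a b u u' v v' :: nat
  assumes "b > 0" and "coprime a b" and "u < b" and "u' < b"
    and "u * a + v * b = u' * a + v' * b"
  shows "u = u' \<and> v = v'"
proof -
  have "[u * a = u' * a] (mod b)"
    using assms(5) unfolding cong_def by (metis mod_mult_self1)
  then have "[u = u'] (mod b)"
    using assms(2) by (simp add: cong_mult_rcancel_nat)
  then have "u = u'"
    using assms(3,4) by (simp add: cong_less_modulus_unique_nat)
  then show ?thesis
    using assms by simp
qed

text \<open>The summand \<open>a * b\<close> leaves room for \<open>u * a\<close> with any
  \<open>u < b\<close>, so the second coefficient cannot become negative.\<close>

lemma small_representation_exists:
  fixes a b s :: nat
  assumes "b > 0" and "coprime a b"
  obtains u v where "u < b" and "s + a * b = u * a + v * b"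
proof -
  obtain x where x: "[a * x = 1] (mod b)"
    using cong_solve_coprime_nat[OF assms(2)] by auto
  \<comment> \<open>As \<open>x\<close> inverts \<open>a\<close> modulo \<open>b\<close>, this is
    the residue that solves \<open>u * a = s\<close> modulo \<open>b\<close>.\<close>
  define u where "u = (x * s) mod b"
  have "u < b"
    using assms by (simp add: u_def)
  then have le: "u * a \<le> s + a * b"
    by (metis less_imp_le mult.commute mult_le_mono2 trans_le_add2)
  have "[u * a = x * s * a] (mod b)"
    unfolding u_def cong_def by (simp add: mod_mult_left_eq)
  also have "[x * s * a = s] (mod b)"
    using cong_mult[OF x cong_refl[of s]] by (simp add: ac_simps)
  also have "[s = s + a * b] (mod b)"
    by (simp add: cong_def)
  finally have "b dvd (s + a * b - u * a)"
    using le by (meson cong_altdef_nat cong_sym)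
  then obtain v where "s + a * b - u * a = v * b"
    by (metis dvdE mult.commute)
  then have "s + a * b = u * a + v * b"
    using le by linarith
  with \<open>u < b\<close> show thesis
    using that by blast
qed

lemma card_representations_add:
  assumes "a > 0" and "b > 0" and "coprime a b"
  shows "card (representations a b (s + a * b)) = Suc (card (representations a b s))"
proof -
  obtain u v where uv: "u < b" "s + a * b = u * a + v * b"
    using small_representation_exists assms by blast
  \<comment> \<open>Trading the extra \<open>a * b\<close> for \<open>b\<close> more copies of
    \<open>a\<close> reaches exactly the representations whose first coefficient is at least
    \<open>b\<close>.\<close>
  let ?f = "\<lambda>(u :: nat, v :: nat). (u + b, v)"
  have "representations a b (s + a * b) = insert (u, v) (?f ` representations a b s)"
  proof (intro equalityI subsetI)
    fix p assume p: "p \<in> representations a b (s + a * b)"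
    obtain x y where xy: "p = (x, y)" by fastforce
    show "p \<in> insert (u, v) (?f ` representations a b s)"
    proof (cases "x < b")
      case True
      then show ?thesis
        using p xy uv small_representation_unique[OF assms(2,3), of x u y v] by simp
    next
      case False
      then obtain z where z: "x = z + b"
        by (metis add.commute le_Suc_ex not_less)
      then have "(z, y) \<in> representations a b s"
        using p xy by (simp add: algebra_simps)
      then show ?thesis
        using xy z by force
    qed
  next
    fix p assume "p \<in> insert (u, v) (?f ` representations a b s)"
    then show "p \<in> representations a b (s + a * b)"
      using uv by (auto simp: algebra_simps)
  qed
  moreover have "(u, v) \<notin> ?f ` representations a b s"
    using uv by auto
  moreover have "inj_on ?f (representations a b s)"
    by (auto simp: inj_on_def)
  ultimately show ?thesis
    using finite_representations[OF assms(1,2)] by (simp add: card_image)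
qed

lemma card_representations_le_1:
  assumes "b > 0" and "coprime a b" and "s < a * b"
  shows "card (representations a b s) \<le> 1"
proof -
  have "u < b" if "(u, v) \<in> representations a b s" for u v
  proof -
    have "u * a < b * a"
      using that assms(3) unfolding mem_representations_iff
      by (metis add_lessD1 mult.commute)
    then show ?thesis by simp
  qed
  then have "p = q" if "p \<in> representations a b s" "q \<in> representations a b s" for p q
    using that small_representation_unique[OF assms(1,2)]
    by (metis mem_representations_iff prod.collapse)
  then show ?thesis
    \<comment> \<open>\<open>card_le_Suc0_iff_eq\<close> covers finite sets; an infinite one would
      have \<open>card\<close> 0.\<close>
    by (metis card_le_Suc0_iff_eq One_nat_def card.infinite zero_le)
qed

lemma card_representations_add_mult:
  assumes "a > 0" and "b > 0" and "coprime a b"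
  shows "card (representations a b (s + m * (a * b))) = card (representations a b s) + m"
proof (induction m)
  case (Suc m)
  have "s + Suc m * (a * b) = s + m * (a * b) + a * b"
    by simp
  then show ?case
    using card_representations_add[OF assms] Suc by presburger
qed simp

lemma mem_apery_set_iff:
  assumes "a > 0" and "b > 0" and "coprime a b"
  shows "s \<in> apery_set (num_semigroup a b) (a * b) \<longleftrightarrow> card (representations a b s) = 1"
proof (cases "s < a * b")
  case True
  then have "int s - int (a * b) < 0"
    by linarith
  then have "int s - int (a * b) \<notin> int ` num_semigroup a b"
    by (metis imageE not_less of_nat_0_le_iff)
  then show ?thesis
    using num_semigroup_iff_card_representations[OF assms(1,2), of s]
      card_representations_le_1[OF assms(2,3) True]
    by (auto simp: apery_set_def)
next
  case False
  then obtain t where t: "s = t + a * b"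
    by (metis add.commute le_Suc_ex not_less)
  \<comment> \<open>So \<open>s\<close> lies in the Apery set iff it has a representation and
    \<open>t\<close> has none; as \<open>s\<close> has one more than \<open>t\<close>, this means
    exactly one.\<close>
  have "int s - int (a * b) \<in> int ` num_semigroup a b \<longleftrightarrow> t \<in> num_semigroup a b"
    unfolding t by auto
  then show ?thesis
    using num_semigroup_iff_card_representations[OF assms(1,2)]
      card_representations_add[OF assms, of t]
    by (simp add: apery_set_def t)
qed

text \<open>This allows \<open>m * (a * b)\<close> to be subtracted from \<open>s\<close> within the
  naturals. The remainder of \<open>s\<close> modulo \<open>a * b\<close> has at most one
  representation, so the quotient must supply at least \<open>m\<close> of the
  \<open>Suc m\<close>.\<close>

lemma le_of_card_representations:
  assumes "a > 0" and "b > 0" and "coprime a b" and "card (representations a b s) = Suc m"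
  shows "m * (a * b) \<le> s"
proof -
  let ?q = "s div (a * b)" and ?r = "s mod (a * b)"
  have "card (representations a b ?r) \<le> 1"
    using assms by (intro card_representations_le_1) simp_all
  moreover have "card (representations a b s) = card (representations a b ?r) + ?q"
    using card_representations_add_mult[OF assms(1-3), of ?r ?q]
    unfolding mod_div_mult_eq .
  ultimately have "m \<le> ?q"
    using assms(4) by linarith
  then show ?thesis
    by (meson div_times_less_eq_dividend le_trans mult_le_mono1)
qed

theorem mainTheorem2:
  fixes a b n :: nat
  assumes "a > 0" and "b > 0" and "coprime a b" and "n \<ge> 1"
  shows "{k + (n - 1) * (a * b) | k. k \<in> apery_set (num_semigroup a b) (a * b)} = rep_set n a b"
proof -
  obtain m where n: "n = Suc m"
    using assms(4) by (cases n) auto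
  note ab = assms(1-3)
  have "s \<in> rep_set n a b \<longleftrightarrow> card (representations a b s) = Suc m" for s
    using num_semigroup_iff_card_representations[OF ab(1,2)] by (auto simp: rep_set_def n)
  \<comment> \<open>Each of the \<open>m = n - 1\<close> shifts by \<open>a * b\<close> adds one
    representation to the single one of \<open>k\<close>.\<close>
  moreover have "card (representations a b s) = Suc m \<longleftrightarrow>
      (\<exists>k. s = k + m * (a * b) \<and> card (representations a b k) = 1)" for s
  proof
    assume s: "card (representations a b s) = Suc m"
    then obtain k where "s = k + m * (a * b)"
      using le_of_card_representations[OF ab] by (metis add.commute le_Suc_ex)
    then show "\<exists>k. s = k + m * (a * b) \<and> card (representations a b k) = 1"
      using s card_representations_add_mult[OF ab, of k m] by auto
  qed (auto simp: card_representations_add_mult[OF ab])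
  ultimately show ?thesis
    using mem_apery_set_iff[OF ab] by (auto simp: n)
qed

end
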